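(* Let $p\in(0,1)$, $f:\{0,1\}^n\to\mathbb{R}$ and $0<\rho\le 1/\sqrt{12}$. Then $$\|\mathrm{T}_\rho f\|_4^4\le\sum_{S\subseteq[n]}(3\lambda\rho^4)^{|S|}\|\mathrm{D}_S f\|_2^4\le\sum_{S\subseteq[n]}(3\sigma^2\rho^4)^{|S|}\mathrm{I}_S(f)^2,$$ where $\sigma=\sqrt{p(1-p)}$ and $\lambda=\sigma^{-2}((1-p)^3+p^3)$.
   Context: Norms are in $L^r(\{0,1\}^n,\mu_p)$, $\mu_p$ the $p$-biased product measure. Let $\chi_i(x)=(x_i-p)/\sigma$ and $\chi_S=\prod_{i\in S}\chi_i$; every $f$ has a unique expansion $f=\sum_S\hat f(S)\chi_S$. Define $\mathrm{T}_\rho f=\sum_S\rho^{|S|}\hat f(S)\chi_S$ (equivalently $\mathrm{T}_\rho f(x)=\mathbb{E}_{\mathbf y\sim N_\rho(x)}f(\mathbf y)$ where each $\mathbf y_i=x_i$ with probability $\rho$ and is otherwise resampled from the $p$-biased bit). The derivative is $\mathrm{D}_S f=\sum_{T\supseteq S}\hat f(T)\chi_{T\setminus S}$ and the generalised influence is $\mathrm{I}_S(f)=\sigma^{-2|S|}\|\mathrm{D}_Sf\|_2^2$. *)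

theory Defs
  imports "HOL-Probability.Probability"
begin

text \<open>
  A point of the discrete cube is a function from coordinates to bits; coordinates outside
  \<open>{1..n}\<close> carry the dummy value \<^const>\<open>False\<close>, so that the cube has exactly
  \<open>2 ^ n\<close> points. A function on the cube is represented by a function on all of
  \<^typ>\<open>nat \<Rightarrow> bool\<close>; its values off the cube never matter.
\<close>

definition cube :: "nat \<Rightarrow> (nat \<Rightarrow> bool) set" where
  "cube n = PiE_dflt {1..n} False (\<lambda>_. UNIV)"

definition biased_pmf :: "real \<Rightarrow> nat \<Rightarrow> (nat \<Rightarrow> bool) pmf" where
  "biased_pmf p n = Pi_pmf {1..n} False (\<lambda>_. bernoulli_pmf p)"

definition Lr_norm :: "real \<Rightarrow> nat \<Rightarrow> real \<Rightarrow> ((nat \<Rightarrow> bool) \<Rightarrow> real) \<Rightarrow> real" where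
  "Lr_norm p n r g = measure_pmf.expectation (biased_pmf p n) (\<lambda>x. \<bar>g x\<bar> powr r) powr (1 / r)"

definition bsigma :: "real \<Rightarrow> real" where
  "bsigma p = sqrt (p * (1 - p))"

definition blambda :: "real \<Rightarrow> real" where
  "blambda p = ((1 - p) ^ 3 + p ^ 3) / (bsigma p)\<^sup>2"

definition chi :: "real \<Rightarrow> nat set \<Rightarrow> (nat \<Rightarrow> bool) \<Rightarrow> real" where
  "chi p S x = (\<Prod>i\<in>S. (of_bool (x i) - p) / bsigma p)"

definition is_fourier_expansion ::
    "real \<Rightarrow> nat \<Rightarrow> ((nat \<Rightarrow> bool) \<Rightarrow> real) \<Rightarrow> (nat set \<Rightarrow> real) \<Rightarrow> bool" where
  "is_fourier_expansion p n f c \<longleftrightarrow>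
     (\<forall>S. \<not> S \<subseteq> {1..n} \<longrightarrow> c S = 0) \<and>
     (\<forall>x\<in>cube n. f x = (\<Sum>S\<in>Pow {1..n}. c S * chi p S x))"

text \<open>
  The description below is well defined for \<open>0 < p < 1\<close>; see \<open>ex1_fourier_expansion\<close>.
\<close>

definition fourier :: "real \<Rightarrow> nat \<Rightarrow> ((nat \<Rightarrow> bool) \<Rightarrow> real) \<Rightarrow> nat set \<Rightarrow> real" where
  "fourier p n f = (THE c. is_fourier_expansion p n f c)"

definition noise :: "real \<Rightarrow> nat \<Rightarrow> real \<Rightarrow> ((nat \<Rightarrow> bool) \<Rightarrow> real) \<Rightarrow> (nat \<Rightarrow> bool) \<Rightarrow> real" where
  "noise p n \<rho> f x = (\<Sum>S\<in>Pow {1..n}. \<rho> ^ card S * fourier p n f S * chi p S x)"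

definition deriv_S ::
    "real \<Rightarrow> nat \<Rightarrow> nat set \<Rightarrow> ((nat \<Rightarrow> bool) \<Rightarrow> real) \<Rightarrow> (nat \<Rightarrow> bool) \<Rightarrow> real" where
  "deriv_S p n S f x = (\<Sum>T | S \<subseteq> T \<and> T \<subseteq> {1..n}. fourier p n f T * chi p (T - S) x)"

definition gen_influence :: "real \<Rightarrow> nat \<Rightarrow> nat set \<Rightarrow> ((nat \<Rightarrow> bool) \<Rightarrow> real) \<Rightarrow> real" where
  "gen_influence p n S f = (Lr_norm p n 2 (deriv_S p n S f))\<^sup>2 / bsigma p ^ (2 * card S)"


lemma mem_cube_iff: "x \<in> cube n \<longleftrightarrow> (\<forall>i. i \<notin> {1..n} \<longrightarrow> \<not> x i)"
  by (auto simp: cube_def PiE_dflt_def)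

lemma sum_Pow_atLeastAtMost_Suc:
  fixes g :: "nat set \<Rightarrow> real"
  shows "(\<Sum>S\<in>Pow {1..Suc n}. g S) =
    (\<Sum>S\<in>Pow {1..n}. g S) + (\<Sum>S\<in>Pow {1..n}. g (insert (Suc n) S))"
proof -
  have "Pow {1..Suc n} = Pow {1..n} \<union> insert (Suc n) ` Pow {1..n}"
    by (simp add: atLeastAtMostSuc_conv Pow_insert)
  moreover have "Pow {1..n} \<inter> insert (Suc n) ` Pow {1..n} = {}"
    by auto
  moreover have "inj_on (insert (Suc n)) (Pow {1..n})"
    by (rule inj_onI) (metis PowD Suc_n_not_le_n atLeastAtMost_iff insert_ident subsetD)
  ultimately show ?thesis
    by (simp add: sum.union_disjoint sum.reindex)
qed

lemma chi_update:
  assumes "S \<subseteq> {1..n}"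
  shows "chi p S (x(Suc n := b)) = chi p S x"
  unfolding chi_def using assms by (intro prod.cong) auto

lemma chi_insert_update:
  assumes "S \<subseteq> {1..n}"
  shows "chi p (insert (Suc n) S) (x(Suc n := b)) = (of_bool b - p) / bsigma p * chi p S x"
proof -
  have "finite S" "Suc n \<notin> S"
    using assms finite_subset by fastforce+
  then have "chi p (insert (Suc n) S) (x(Suc n := b)) =
      (of_bool b - p) / bsigma p * chi p S (x(Suc n := b))"
    by (simp add: chi_def)
  then show ?thesis
    by (simp add: chi_update[OF assms])
qed

lemma sum_chi_update:
  "(\<Sum>S\<in>Pow {1..Suc n}. c S * chi p S (x(Suc n := b))) =
     (\<Sum>S\<in>Pow {1..n}. c S * chi p S x) +
     (of_bool b - p) / bsigma p * (\<Sum>S\<in>Pow {1..n}. c (insert (Suc n) S) * chi p S x)"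
  unfolding sum_Pow_atLeastAtMost_Suc sum_distrib_left
  by (intro arg_cong2[of _ _ _ _ "(+)"] sum.cong)
     (auto simp: chi_update chi_insert_update simp del: fun_upd_apply)

lemma bsigma_pos: "0 < p \<Longrightarrow> p < 1 \<Longrightarrow> 0 < bsigma p"
  by (simp add: bsigma_def)

lemma ex_fourier_expansion:
  assumes "0 < p" "p < 1"
  shows "\<exists>c. \<forall>x\<in>cube n. f x = (\<Sum>S\<in>Pow {1..n}. c S * chi p S x)"
proof (induction n arbitrary: f)
  case 0
  have "cube 0 = {\<lambda>_. False}"
    by (auto simp: mem_cube_iff)
  then show ?case
    by (intro exI[of _ "\<lambda>_. f (\<lambda>_. False)"]) (simp add: chi_def)
next
  case (Suc n)
  define f0 where "f0 = (\<lambda>x. f (x(Suc n := False)))"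
  define f1 where "f1 = (\<lambda>x. f (x(Suc n := True)))"
  obtain a where a: "\<And>x. x \<in> cube n \<Longrightarrow>
      (1 - p) * f0 x + p * f1 x = (\<Sum>S\<in>Pow {1..n}. a S * chi p S x)"
    using Suc.IH[of "\<lambda>x. (1 - p) * f0 x + p * f1 x"] by blast
  obtain b where b: "\<And>x. x \<in> cube n \<Longrightarrow>
      (f1 x - f0 x) * bsigma p = (\<Sum>S\<in>Pow {1..n}. b S * chi p S x)"
    using Suc.IH[of "\<lambda>x. (f1 x - f0 x) * bsigma p"] by blast
  define c where "c S = (if Suc n \<in> S then b (S - {Suc n}) else a S)" for S
  have "f x = (\<Sum>S\<in>Pow {1..Suc n}. c S * chi p S x)" if x: "x \<in> cube (Suc n)" for x
  proof -
    define y where "y = x(Suc n := False)"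
    have y: "y \<in> cube n"
      using x by (auto simp: mem_cube_iff y_def)
    have xy: "x = y(Suc n := x (Suc n))"
      by (simp add: y_def)
    have ca: "(\<Sum>S\<in>Pow {1..n}. c S * chi p S y) = (\<Sum>S\<in>Pow {1..n}. a S * chi p S y)"
      by (rule sum.cong) (auto simp: c_def)
    have "insert (Suc n) S - {Suc n} = S" if "S \<in> Pow {1..n}" for S
      using that by fastforce
    then have cb: "(\<Sum>S\<in>Pow {1..n}. c (insert (Suc n) S) * chi p S y)
        = (\<Sum>S\<in>Pow {1..n}. b S * chi p S y)"
      by (intro sum.cong) (simp_all add: c_def)
    have "(\<Sum>S\<in>Pow {1..Suc n}. c S * chi p S x) =
        ((1 - p) * f0 y + p * f1 y) +
        (of_bool (x (Suc n)) - p) / bsigma p * ((f1 y - f0 y) * bsigma p)"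
      by (subst xy) (simp only: sum_chi_update ca cb a[OF y] b[OF y])
    also have "\<dots> = (if x (Suc n) then f1 y else f0 y)"
      using bsigma_pos[OF assms] by (simp add: field_simps)
    also have "\<dots> = f x"
      unfolding f0_def f1_def by (metis xy)
    finally show ?thesis ..
  qed
  then show ?case by blast
qed

lemma fourier_expansion_zero:
  assumes "0 < p" "p < 1"
    and "\<And>x. x \<in> cube n \<Longrightarrow> (\<Sum>S\<in>Pow {1..n}. d S * chi p S x) = 0"
    and "S \<subseteq> {1..n}"
  shows "d S = 0"
  using assms(3,4)
proof (induction n arbitrary: d S)
  case 0
  then show ?case
    using "0.prems"(1)[of "\<lambda>_. False"] by (simp add: mem_cube_iff chi_def)
next
  case (Suc n)
  have eq: "(\<Sum>S\<in>Pow {1..n}. d S * chi p S y) +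
      (of_bool b - p) / bsigma p * (\<Sum>S\<in>Pow {1..n}. d (insert (Suc n) S) * chi p S y) = 0"
    if "y \<in> cube n" for y b
    unfolding sum_chi_update[symmetric]
    by (rule Suc.prems(1)) (use that in \<open>auto simp: mem_cube_iff\<close>)
  have ins: "(\<Sum>S\<in>Pow {1..n}. d (insert (Suc n) S) * chi p S y) = 0" if "y \<in> cube n" for y
    using eq[OF that, of True] eq[OF that, of False] bsigma_pos[OF assms(1,2)]
    by (simp add: field_simps)
  have noins: "(\<Sum>S\<in>Pow {1..n}. d S * chi p S y) = 0" if "y \<in> cube n" for y
    using eq[OF that, of True] ins[OF that] by simp
  show ?case
  proof (cases "Suc n \<in> S")
    case True
    have "d (insert (Suc n) (S - {Suc n})) = 0"
      by (rule Suc.IH[of "\<lambda>S. d (insert (Suc n) S)"])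
         (use ins Suc.prems(2) in \<open>auto simp: le_Suc_eq\<close>)
    then show ?thesis
      using True by (simp add: insert_absorb)
  next
    case False
    then have "S \<subseteq> {1..n}"
      using Suc.prems(2) by (metis atLeastAtMostSuc_conv le_add1 plus_1_eq_Suc subset_insert)
    then show ?thesis
      by (rule Suc.IH[of d, rotated]) (rule noins)
  qed
qed

lemma ex1_fourier_expansion:
  assumes "0 < p" "p < 1"
  shows "\<exists>!c. is_fourier_expansion p n f c"
proof -
  obtain c where c: "\<And>x. x \<in> cube n \<Longrightarrow> f x = (\<Sum>S\<in>Pow {1..n}. c S * chi p S x)"
    using ex_fourier_expansion[OF assms] by blast
  show ?thesis
  proof (rule ex_ex1I)
    have "is_fourier_expansion p n f (\<lambda>S. if S \<subseteq> {1..n} then c S else 0)"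
      unfolding is_fourier_expansion_def using c by (auto intro!: sum.cong)
    then show "\<exists>c. is_fourier_expansion p n f c" by blast
  next
    fix c c' assume *: "is_fourier_expansion p n f c" "is_fourier_expansion p n f c'"
    have "c S - c' S = 0" if "S \<subseteq> {1..n}" for S
      by (rule fourier_expansion_zero[OF assms _ that, where d = "\<lambda>S. c S - c' S"])
         (use * in \<open>simp add: is_fourier_expansion_def left_diff_distrib sum_subtractf\<close>)
    with * show "c = c'"
      unfolding is_fourier_expansion_def by (metis eq_iff_diff_eq_0 ext)
  qed
qed

lemma is_fourier_expansion_fourier:
  assumes "0 < p" "p < 1"
  shows "is_fourier_expansion p n f (fourier p n f)"
  unfolding fourier_def by (rule theI'[OF ex1_fourier_expansion[OF assms]])

end

theory Submission
  imports Defs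
begin

text \<open>
  Induction on the dimension, splitting off the last coordinate as \<open>f = g + \<chi> h\<close>, needs a bound
  on a mixed moment \<open>E[(T g)\<^sup>2 (T h)\<^sup>2]\<close>, and Cauchy--Schwarz is too lossy there. The remedy is to
  prove the inequality for functions with values in a Euclidean space: then the pointwise estimate
  \<open>E|T f|\<^sup>4 \<le> E(|T g|\<^sup>2 + |T h|\<^sup>2)\<^sup>2 + 3\<lambda>\<rho>\<^sup>4 E|T h|\<^sup>4\<close> lets one apply the induction hypothesis to
  the concatenated vector \<open>(g, h)\<close> and to \<open>h\<close>.
\<close>

section \<open>Expectations and Fourier sums, one coordinate at a time\<close>

abbreviation expect :: "real \<Rightarrow> nat \<Rightarrow> ((nat \<Rightarrow> bool) \<Rightarrow> real) \<Rightarrow> real" where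
  "expect p n \<equiv> measure_pmf.expectation (biased_pmf p n)"

text \<open>Takes a coefficient family rather than a function: fixing the last bit or applying noise
  then only reindexes or rescales coefficients, and \<open>fourier\<close> of the resulting
  functions need not be determined.\<close>

definition fourier_sum :: "real \<Rightarrow> nat \<Rightarrow> (nat set \<Rightarrow> real) \<Rightarrow> (nat \<Rightarrow> bool) \<Rightarrow> real" where
  "fourier_sum p n c x = (\<Sum>S\<in>Pow {1..n}. c S * chi p S x)"

text \<open>The squared L2 norm of the derivative in direction \<open>S\<close>, see
  \<open>expect_deriv_S\<close>. The indicator keeps the sum over a full power set, which splits
  along the last coordinate.\<close>

definition superset_weight :: "nat \<Rightarrow> (nat set \<Rightarrow> real) \<Rightarrow> nat set \<Rightarrow> real" where
  "superset_weight n c S = (\<Sum>T\<in>Pow {1..n}. of_bool (S \<subseteq> T) * (c T)\<^sup>2)"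

lemma finite_set_biased_pmf: "finite (set_pmf (biased_pmf p n))"
  unfolding biased_pmf_def
  by (rule finite_subset[OF set_Pi_pmf_subset'], simp) (intro finite_PiE_dflt; simp)

lemma integrable_biased_pmf [simp]:
  fixes F :: "(nat \<Rightarrow> bool) \<Rightarrow> real"
  shows "integrable (measure_pmf (biased_pmf p n)) F"
  by (rule integrable_measure_pmf_finite[OF finite_set_biased_pmf])

lemma expect_mono: "(\<And>x. F x \<le> G x) \<Longrightarrow> expect p n F \<le> expect p n G"
  by (rule integral_mono) auto

lemma expect_0: "expect p 0 F = F (\<lambda>_. False)"
  by (simp add: biased_pmf_def)

lemma expect_Suc:
  assumes "0 \<le> p" "p \<le> 1"
  shows "expect p (Suc n) F =
    expect p n (\<lambda>x. (1 - p) * F (x(Suc n := False)) + p * F (x(Suc n := True)))"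
proof -
  have "biased_pmf p (Suc n) = bernoulli_pmf p \<bind> (\<lambda>b. map_pmf (\<lambda>x. x(Suc n := b)) (biased_pmf p n))"
    unfolding biased_pmf_def atLeastAtMostSuc_conv[of 1 n, OF le_add1[of 1 n, unfolded plus_1_eq_Suc]]
    by (subst Pi_pmf_insert') (simp_all add: map_pmf_def)
  also have "measure_pmf.expectation \<dots> F =
      (\<Sum>b\<in>UNIV. pmf (bernoulli_pmf p) b *\<^sub>R expect p n (\<lambda>x. F (x(Suc n := b))))"
    by (subst pmf_expectation_bind[where A = UNIV]) (auto simp: finite_set_biased_pmf)
  finally show ?thesis
    using assms by (simp add: UNIV_bool algebra_simps del: fun_upd_apply)
qed

lemma fourier_sum_Suc:
  "fourier_sum p (Suc n) c (x(Suc n := b)) =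
     fourier_sum p n c x + (of_bool b - p) / bsigma p * fourier_sum p n (\<lambda>S. c (insert (Suc n) S)) x"
  unfolding fourier_sum_def by (rule sum_chi_update)

lemma fourier_sum_cong:
  "(\<And>S. S \<subseteq> {1..n} \<Longrightarrow> c S = d S) \<Longrightarrow> fourier_sum p n c = fourier_sum p n d"
  by (auto simp: fourier_sum_def fun_eq_iff intro!: sum.cong)

lemma fourier_sum_cmult: "fourier_sum p n (\<lambda>S. a * c S) x = a * fourier_sum p n c x"
  by (simp add: fourier_sum_def sum_distrib_left mult.assoc)

section \<open>Parseval and the L2 norms of derivatives\<close>

text \<open>A single character has mean 0 and second moment 1, so averaging
  \<open>(G + chi H)^2\<close> over the last bit loses the cross term and leaves
  \<open>G^2 + H^2\<close>.\<close>

lemma parseval: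
  assumes "0 < p" "p < 1"
  shows "expect p n (\<lambda>x. (fourier_sum p n c x)\<^sup>2) = (\<Sum>S\<in>Pow {1..n}. (c S)\<^sup>2)"
proof (induction n arbitrary: c)
  case 0
  show ?case by (simp add: expect_0 fourier_sum_def chi_def)
next
  case (Suc n)
  have s: "(bsigma p)\<^sup>2 = p * (1 - p)"
    using assms by (simp add: bsigma_def)
  have s0: "bsigma p \<noteq> 0"
    using bsigma_pos[OF assms] by simp
  have "(1 - p) * (G + (0 - p) / bsigma p * H)\<^sup>2 + p * (G + (1 - p) / bsigma p * H)\<^sup>2 = G\<^sup>2 + H\<^sup>2"
    for G H :: real
  proof -
    have "(1 - p) * (G + (0 - p) / bsigma p * H)\<^sup>2 + p * (G + (1 - p) / bsigma p * H)\<^sup>2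
        = G\<^sup>2 + (p * (1 - p)) / (bsigma p)\<^sup>2 * H\<^sup>2"
      using s0 by (simp add: field_simps power2_eq_square)
    then show ?thesis
      unfolding s[symmetric] using s0 by simp
  qed
  then show ?case
    unfolding sum_Pow_atLeastAtMost_Suc
    using assms by (simp add: expect_Suc fourier_sum_Suc Suc.IH del: fun_upd_apply)
qed

lemma sum_supersets:
  fixes g :: "nat set \<Rightarrow> real"
  assumes "S \<subseteq> {1..n}"
  shows "(\<Sum>T | S \<subseteq> T \<and> T \<subseteq> {1..n}. g T) = (\<Sum>U\<in>Pow {1..n}. of_bool (U \<inter> S = {}) * g (U \<union> S))"
proof -
  have "(\<Sum>T | S \<subseteq> T \<and> T \<subseteq> {1..n}. g T) = (\<Sum>U | U \<subseteq> {1..n} \<and> U \<inter> S = {}. g (U \<union> S))"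
    by (rule sum.reindex_bij_witness[of _ "\<lambda>U. U \<union> S" "\<lambda>T. T - S"])
       (use assms in \<open>auto intro!: arg_cong[of _ _ g]\<close>)
  also have "\<dots> = (\<Sum>U\<in>Pow {1..n}. of_bool (U \<inter> S = {}) * g (U \<union> S))"
    by (rule sum.mono_neutral_cong_left) auto
  finally show ?thesis .
qed

lemma expect_deriv_S:
  assumes "0 < p" "p < 1" "S \<subseteq> {1..n}"
  shows "expect p n (\<lambda>x. (deriv_S p n S f x)\<^sup>2) = superset_weight n (fourier p n f) S"
proof -
  let ?c = "fourier p n f"
  \<comment> \<open>Coefficients of the derivative: \<open>chi p U\<close> with \<open>U\<close>
    disjoint from \<open>S\<close> arises exactly from \<open>T = U \<union> S\<close>.\<close>
  let ?d = "\<lambda>U. of_bool (U \<inter> S = {}) * ?c (U \<union> S)"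
  have "deriv_S p n S f x = fourier_sum p n ?d x" for x
    unfolding deriv_S_def sum_supersets[OF assms(3)] fourier_sum_def
    by (rule sum.cong) (auto simp: Un_Diff Diff_triv)
  then have "expect p n (\<lambda>x. (deriv_S p n S f x)\<^sup>2) = (\<Sum>U\<in>Pow {1..n}. (?d U)\<^sup>2)"
    by (simp only: parseval[OF assms(1,2)])
  also have "\<dots> = (\<Sum>U\<in>Pow {1..n}. of_bool (U \<inter> S = {}) * (?c (U \<union> S))\<^sup>2)"
    by (rule sum.cong) auto
  also have "\<dots> = (\<Sum>T | S \<subseteq> T \<and> T \<subseteq> {1..n}. (?c T)\<^sup>2)"
    by (rule sum_supersets[OF assms(3), symmetric])
  also have "\<dots> = superset_weight n ?c S"
    unfolding superset_weight_def by (rule sum.mono_neutral_cong_left) auto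
  finally show ?thesis .
qed

text \<open>Supersets of \<open>S\<close> either avoid or contain \<open>Suc n\<close>; those of
  \<open>insert (Suc n) S\<close> all contain it. These are the two kinds of weight that
  \<open>(g, h)\<close> and \<open>h\<close> contribute in the induction.\<close>

lemma superset_weight_Suc:
  assumes "S \<subseteq> {1..n}"
  shows "superset_weight (Suc n) c S =
      superset_weight n c S + superset_weight n (\<lambda>T. c (insert (Suc n) T)) S"
    and "superset_weight (Suc n) c (insert (Suc n) S) =
      superset_weight n (\<lambda>T. c (insert (Suc n) T)) S"
proof -
  have [simp]: "Suc n \<notin> S" using assms by auto
  have [simp]: "S \<subseteq> insert (Suc n) T \<longleftrightarrow> S \<subseteq> T" for T
    by auto
  have [simp]: "insert (Suc n) S \<subseteq> insert (Suc n) T \<longleftrightarrow> S \<subseteq> T" for T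
    by auto
  show "superset_weight (Suc n) c S =
      superset_weight n c S + superset_weight n (\<lambda>T. c (insert (Suc n) T)) S"
    unfolding superset_weight_def sum_Pow_atLeastAtMost_Suc by simp
  have "(\<Sum>T\<in>Pow {1..n}. of_bool (insert (Suc n) S \<subseteq> T) * (c T)\<^sup>2) = 0"
    by (rule sum.neutral) auto
  then show "superset_weight (Suc n) c (insert (Suc n) S) =
      superset_weight n (\<lambda>T. c (insert (Suc n) T)) S"
    unfolding superset_weight_def sum_Pow_atLeastAtMost_Suc by simp
qed

section \<open>The two-point inequality\<close>

text \<open>With \<open>A = |G|\<^sup>2\<close>, \<open>B = |H|\<^sup>2\<close> and \<open>I = \<langle>G, H\<rangle>\<close> this bounds the average over the last bit of
  \<open>|G + \<rho>\<chi>H|\<^sup>4\<close>. The third moment \<open>\<kappa>\<close> of \<open>\<chi>\<close> satisfies \<open>\<kappa>\<^sup>2 = \<lambda> - 1\<close>.\<close>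

lemma two_point_bound:
  fixes A B I \<rho> p :: real
  assumes "0 < p" "p < 1" and \<rho>: "\<rho>\<^sup>2 \<le> 1 / 4" and AB: "0 \<le> A" "0 \<le> B" "I\<^sup>2 \<le> A * B"
  defines "t0 \<equiv> (0 - p) / bsigma p" and "t1 \<equiv> (1 - p) / bsigma p"
  shows "(1 - p) * (A + 2 * \<rho> * t0 * I + (\<rho> * t0)\<^sup>2 * B)\<^sup>2 + p * (A + 2 * \<rho> * t1 * I + (\<rho> * t1)\<^sup>2 * B)\<^sup>2
     \<le> (A + B)\<^sup>2 + 3 * blambda p * \<rho> ^ 4 * B\<^sup>2"
proof -
  define \<kappa> where "\<kappa> = (1 - 2 * p) / bsigma p"
  have s: "(bsigma p)\<^sup>2 = p * (1 - p)"
    using assms(1,2) by (simp add: bsigma_def)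
  have s0: "bsigma p \<noteq> 0"
    using bsigma_pos[OF assms(1,2)] by simp
  have pp: "p * (1 - p) \<noteq> 0"
    using assms(1,2) by simp
  \<comment> \<open>Reducing powers of \<open>bsigma p\<close> to at most one square root factor
    turns the moment formulas into polynomial identities.\<close>
  have s3: "(bsigma p) ^ 3 = p * (1 - p) * bsigma p"
    unfolding s[symmetric] by algebra
  have s4: "(bsigma p) ^ 4 = (p * (1 - p)) * (p * (1 - p))"
    unfolding s[symmetric] by algebra
  \<comment> \<open>The first four moments of a single character: 0, 1, \<kappa> and
    \<lambda>.\<close>
  have m1: "(1 - p) * t0 + p * t1 = 0"
    using s0 by (simp add: t0_def t1_def field_simps)
  have m2: "(1 - p) * t0\<^sup>2 + p * t1\<^sup>2 = 1"
    unfolding t0_def t1_def power_divide s using pp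
    by (simp add: divide_simps) algebra
  have m3: "(1 - p) * t0 ^ 3 + p * t1 ^ 3 = \<kappa>"
    unfolding t0_def t1_def \<kappa>_def power_divide s3 using pp s0
    by (simp add: divide_simps) algebra
  have m4: "(1 - p) * t0 ^ 4 + p * t1 ^ 4 = blambda p"
    unfolding t0_def t1_def blambda_def power_divide s4 s using pp
    by (simp add: divide_simps) algebra
  have \<kappa>: "\<kappa>\<^sup>2 = blambda p - 1"
    unfolding \<kappa>_def blambda_def power_divide s using pp
    by (simp add: divide_simps) algebra
  have "(1 - p) * (A + 2 * \<rho> * t0 * I + (\<rho> * t0)\<^sup>2 * B)\<^sup>2 + p * (A + 2 * \<rho> * t1 * I + (\<rho> * t1)\<^sup>2 * B)\<^sup>2
     = A\<^sup>2 + 4 * \<rho> * A * I * ((1 - p) * t0 + p * t1)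
       + (4 * \<rho>\<^sup>2 * I\<^sup>2 + 2 * \<rho>\<^sup>2 * A * B) * ((1 - p) * t0\<^sup>2 + p * t1\<^sup>2)
       + 4 * \<rho> ^ 3 * I * B * ((1 - p) * t0 ^ 3 + p * t1 ^ 3)
       + \<rho> ^ 4 * B\<^sup>2 * ((1 - p) * t0 ^ 4 + p * t1 ^ 4)"
    by algebra
  also have "\<dots> = A\<^sup>2 + 4 * \<rho>\<^sup>2 * I\<^sup>2 + 2 * \<rho>\<^sup>2 * A * B + 4 * \<rho> ^ 3 * I * B * \<kappa> + \<rho> ^ 4 * B\<^sup>2 * blambda p"
    unfolding m1 m2 m3 m4 by simp
  \<comment> \<open>AM-GM on \<rho>I and \<open>\<rho>\<^sup>2 * B * \<kappa>\<close>. As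
    \<open>\<kappa>\<^sup>2 = \<lambda> - 1\<close>, the last term joins the fourth moment term to
    give the coefficient 3\<lambda>, with a negative square to spare.\<close>
  also have "4 * \<rho> ^ 3 * I * B * \<kappa> \<le> 2 * \<rho>\<^sup>2 * I\<^sup>2 + 2 * \<rho> ^ 4 * B\<^sup>2 * \<kappa>\<^sup>2"
  proof -
    have "2 * \<rho>\<^sup>2 * I\<^sup>2 + 2 * \<rho> ^ 4 * B\<^sup>2 * \<kappa>\<^sup>2 - 4 * \<rho> ^ 3 * I * B * \<kappa> = 2 * (\<rho> * I - \<rho>\<^sup>2 * B * \<kappa>)\<^sup>2"
      by algebra
    then show ?thesis
      using zero_le_power2[of "\<rho> * I - \<rho>\<^sup>2 * B * \<kappa>"] by linarith
  qed
  also have "A\<^sup>2 + 4 * \<rho>\<^sup>2 * I\<^sup>2 + 2 * \<rho>\<^sup>2 * A * B + (2 * \<rho>\<^sup>2 * I\<^sup>2 + 2 * \<rho> ^ 4 * B\<^sup>2 * \<kappa>\<^sup>2) + \<rho> ^ 4 * B\<^sup>2 * blambda p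
     = A\<^sup>2 + 6 * (\<rho>\<^sup>2 * I\<^sup>2) + 2 * (\<rho>\<^sup>2 * (A * B)) + 3 * blambda p * \<rho> ^ 4 * B\<^sup>2 - 2 * (\<rho>\<^sup>2 * B)\<^sup>2"
    unfolding \<kappa> by algebra
  \<comment> \<open>Cauchy-Schwarz turns the six copies of \<open>I\<^sup>2\<close> into
    \<open>A * B\<close>, making eight in total; the negative square is dropped.\<close>
  also have "\<dots> \<le> A\<^sup>2 + 8 * (\<rho>\<^sup>2 * (A * B)) + 3 * blambda p * \<rho> ^ 4 * B\<^sup>2"
    using mult_left_mono[OF AB(3), of "\<rho>\<^sup>2"] zero_le_power2[of "\<rho>\<^sup>2 * B"]
      zero_le_power2[of \<rho>] by linarith
  \<comment> \<open>The bound 1/4 on \<open>\<rho>\<^sup>2\<close> brings the factor 8 down to 2,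
    the cross term of \<open>(A + B)\<^sup>2\<close>.\<close>
  also have "\<dots> \<le> A\<^sup>2 + 2 * (A * B) + B\<^sup>2 + 3 * blambda p * \<rho> ^ 4 * B\<^sup>2"
    using mult_right_mono[OF \<rho>, of "A * B"] mult_nonneg_nonneg[OF AB(1,2)] zero_le_power2[of B]
    by linarith
  finally show ?thesis
    by (simp add: power2_sum algebra_simps)
qed

section \<open>The inequality for vector-valued functions\<close>

lemma sum_lessThan_add:
  fixes F :: "nat \<Rightarrow> real"
  shows "(\<Sum>j<m + k. F j) = (\<Sum>j<m. F j) + (\<Sum>j<k. F (m + j))"
  by (induction k) simp_all

lemma sum_lessThan_double:
  fixes g h :: "nat \<Rightarrow> real"
  shows "(\<Sum>j<m + m. if j < m then g j else h (j - m)) = (\<Sum>j<m. g j) + (\<Sum>j<m. h j)"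
  by (simp add: sum_lessThan_add)

text \<open>The components are indexed by \<open>j < m\<close>, and the sum of weights is the
  squared L2 norm of the vector-valued derivative. The induction must leave \<open>m\<close>
  arbitrary because concatenation doubles it.\<close>

lemma vector_hypercontractivity:
  fixes c :: "nat \<Rightarrow> nat set \<Rightarrow> real"
  assumes p: "0 < p" "p < 1" and \<rho>: "\<rho>\<^sup>2 \<le> 1 / 4"
  shows "expect p n (\<lambda>x. (\<Sum>j<m. (fourier_sum p n (\<lambda>S. \<rho> ^ card S * c j S) x)\<^sup>2)\<^sup>2)
    \<le> (\<Sum>S\<in>Pow {1..n}. (3 * blambda p * \<rho> ^ 4) ^ card S * (\<Sum>j<m. superset_weight n (c j) S)\<^sup>2)"
proof (induction n arbitrary: m c)
  case 0
  show ?case by (simp add: expect_0 fourier_sum_def superset_weight_def chi_def)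
next
  case (Suc n)
  let ?w = "3 * blambda p * \<rho> ^ 4"
  define h where "h = (\<lambda>j S. c j (insert (Suc n) S))"
  define G where "G = (\<lambda>j. fourier_sum p n (\<lambda>S. \<rho> ^ card S * c j S))"
  define H where "H = (\<lambda>j. fourier_sum p n (\<lambda>S. \<rho> ^ card S * h j S))"
  define A where "A = (\<lambda>x. \<Sum>j<m. (G j x)\<^sup>2)"
  define B where "B = (\<lambda>x. \<Sum>j<m. (H j x)\<^sup>2)"
  define I where "I = (\<lambda>x. \<Sum>j<m. G j x * H j x)"
  define a where "a = (\<lambda>S. \<Sum>j<m. superset_weight n (c j) S)"
  define b where "b = (\<lambda>S. \<Sum>j<m. superset_weight n (h j) S)"
  have card: "card (insert (Suc n) S) = Suc (card S)" if "S \<subseteq> {1..n}" for S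
    using that by (subst card_insert_disjoint) (auto intro: finite_subset)
  \<comment> \<open>One factor \<rho> belongs to the coordinate \<open>Suc n\<close> and is pulled
    out, so that \<open>H\<close> is the noise operator in \<open>n\<close> variables applied to
    \<open>h\<close>.\<close>
  have "fourier_sum p n (\<lambda>S. \<rho> ^ card (insert (Suc n) S) * c j (insert (Suc n) S)) x = \<rho> * H j x" for j x
  proof -
    have "fourier_sum p n (\<lambda>S. \<rho> ^ card (insert (Suc n) S) * c j (insert (Suc n) S))
        = fourier_sum p n (\<lambda>S. \<rho> * (\<rho> ^ card S * h j S))"
      by (rule fourier_sum_cong) (simp add: card h_def)
    then show ?thesis
      by (simp add: fourier_sum_cmult H_def)
  qed
  then have split: "fourier_sum p (Suc n) (\<lambda>S. \<rho> ^ card S * c j S) (x(Suc n := e)) =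
      G j x + (of_bool e - p) / bsigma p * (\<rho> * H j x)" for j x e
    by (simp only: fourier_sum_Suc G_def)
  have quad: "(\<Sum>j<m. (G j x + t * (\<rho> * H j x))\<^sup>2) = A x + 2 * \<rho> * t * I x + (\<rho> * t)\<^sup>2 * B x" for x t
    by (simp add: A_def B_def I_def sum_distrib_left power2_sum power_mult_distrib sum.distrib
        algebra_simps)
  have step: "expect p (Suc n) (\<lambda>x. (\<Sum>j<m. (fourier_sum p (Suc n) (\<lambda>S. \<rho> ^ card S * c j S) x)\<^sup>2)\<^sup>2)
      \<le> expect p n (\<lambda>x. (A x + B x)\<^sup>2 + ?w * (B x)\<^sup>2)"
  proof -
    have "(I x)\<^sup>2 \<le> A x * B x" for x
      unfolding I_def A_def B_def by (rule Cauchy_Schwarz_ineq_sum)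
    moreover have "0 \<le> A x" "0 \<le> B x" for x
      by (simp_all add: A_def B_def sum_nonneg)
    ultimately show ?thesis
      unfolding expect_Suc[OF less_imp_le[OF p(1)] less_imp_le[OF p(2)]] split quad
      by (intro expect_mono) (use two_point_bound[OF p \<rho>] in simp)
  qed
  have w: "0 \<le> ?w"
    using p by (simp add: blambda_def)
  have gh: "expect p n (\<lambda>x. (A x + B x)\<^sup>2) \<le> (\<Sum>S\<in>Pow {1..n}. ?w ^ card S * (a S + b S)\<^sup>2)"
  proof -
    \<comment> \<open>The concatenated vector: its squared length after noise is
      \<open>A + B\<close>, and its weights are \<open>a + b\<close>.\<close>
    define d where "d = (\<lambda>j. if j < m then c j else h (j - m))"
    have "(fourier_sum p n (\<lambda>S. \<rho> ^ card S * d j S) x)\<^sup>2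
        = (if j < m then (G j x)\<^sup>2 else (H (j - m) x)\<^sup>2)" for j x
      by (simp add: d_def G_def H_def)
    then have "(\<Sum>j<m + m. (fourier_sum p n (\<lambda>S. \<rho> ^ card S * d j S) x)\<^sup>2) = A x + B x" for x
      by (simp only: sum_lessThan_double[where g = "\<lambda>j. (G j x)\<^sup>2" and h = "\<lambda>j. (H j x)\<^sup>2"] A_def B_def)
    moreover have "superset_weight n (d j) S
        = (if j < m then superset_weight n (c j) S else superset_weight n (h (j - m)) S)" for j S
      by (simp add: d_def)
    then have "(\<Sum>j<m + m. superset_weight n (d j) S) = a S + b S" for S
      by (simp only: sum_lessThan_double[where g = "\<lambda>j. superset_weight n (c j) S"
            and h = "\<lambda>j. superset_weight n (h j) S"] a_def b_def)
    ultimately show ?thesis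
      using Suc.IH[of d "m + m"] by simp
  qed
  have hh: "expect p n (\<lambda>x. (B x)\<^sup>2) \<le> (\<Sum>S\<in>Pow {1..n}. ?w ^ card S * (b S)\<^sup>2)"
    unfolding B_def H_def b_def by (rule Suc.IH)
  have "expect p n (\<lambda>x. (A x + B x)\<^sup>2 + ?w * (B x)\<^sup>2)
      = expect p n (\<lambda>x. (A x + B x)\<^sup>2) + ?w * expect p n (\<lambda>x. (B x)\<^sup>2)"
    by simp
  also have "\<dots> \<le> (\<Sum>S\<in>Pow {1..n}. ?w ^ card S * (a S + b S)\<^sup>2)
      + ?w * (\<Sum>S\<in>Pow {1..n}. ?w ^ card S * (b S)\<^sup>2)"
    by (intro add_mono gh mult_left_mono hh w)
  \<comment> \<open>Sets avoiding \<open>Suc n\<close> carry \<open>a + b\<close>; sets containing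
    it carry \<open>b\<close>, and their extra element accounts for the factor
    \<open>?w\<close>.\<close>
  also have "\<dots> = (\<Sum>S\<in>Pow {1..Suc n}. ?w ^ card S * (\<Sum>j<m. superset_weight (Suc n) (c j) S)\<^sup>2)"
    unfolding sum_Pow_atLeastAtMost_Suc sum_distrib_left
    by (intro arg_cong2[of _ _ _ _ "(+)"] sum.cong)
       (simp_all add: superset_weight_Suc sum.distrib card a_def b_def h_def mult.assoc)
  finally show ?case
    using step by linarith
qed

section \<open>Norms as moments, and the two inequalities\<close>

lemma Lr_norm_2: "(Lr_norm p n 2 g)\<^sup>2 = expect p n (\<lambda>x. (g x)\<^sup>2)"
proof -
  have "\<bar>y\<bar> powr 2 = y\<^sup>2" for y :: real
    by simp
  then show ?thesis
    by (simp add: Lr_norm_def powr_half_sqrt)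
qed

lemma Lr_norm_4: "Lr_norm p n 4 g ^ 4 = expect p n (\<lambda>x. g x ^ 4)"
proof -
  have "\<bar>y\<bar> powr 4 = y ^ 4" for y :: real
    by simp
  moreover have "0 \<le> expect p n (\<lambda>x. g x ^ 4)"
    by (rule integral_nonneg_AE) auto
  then have "(expect p n (\<lambda>x. g x ^ 4) powr (1 / 4)) ^ 4 = expect p n (\<lambda>x. g x ^ 4)"
    by (cases "expect p n (\<lambda>x. g x ^ 4) = 0") (simp_all add: powr_power)
  ultimately show ?thesis
    by (simp add: Lr_norm_def)
qed

theorem theorem5p4:
  fixes p \<rho> :: real and n :: nat and f :: "(nat \<Rightarrow> bool) \<Rightarrow> real"
  assumes "0 < p" "p < 1" and "0 < \<rho>" "\<rho> \<le> 1 / sqrt 12"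
  shows "Lr_norm p n 4 (noise p n \<rho> f) ^ 4
           \<le> (\<Sum>S\<in>Pow {1..n}. (3 * blambda p * \<rho> ^ 4) ^ card S * Lr_norm p n 2 (deriv_S p n S f) ^ 4)
       \<and> (\<Sum>S\<in>Pow {1..n}. (3 * blambda p * \<rho> ^ 4) ^ card S * Lr_norm p n 2 (deriv_S p n S f) ^ 4)
           \<le> (\<Sum>S\<in>Pow {1..n}. (3 * (bsigma p)\<^sup>2 * \<rho> ^ 4) ^ card S * (gen_influence p n S f)\<^sup>2)"
proof
  have "\<rho>\<^sup>2 \<le> (1 / sqrt 12)\<^sup>2"
    using assms(3,4) by (intro power_mono) auto
  then have \<rho>: "\<rho>\<^sup>2 \<le> 1 / 4"
    by (simp add: power_divide)
  have "noise p n \<rho> f x = fourier_sum p n (\<lambda>S. \<rho> ^ card S * fourier p n f S) x" for x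
    by (simp add: noise_def fourier_sum_def)
  \<comment> \<open>A real function is a vector with one component, so \<open>m = 1\<close>.\<close>
  then have "Lr_norm p n 4 (noise p n \<rho> f) ^ 4 = expect p n
      (\<lambda>x. (\<Sum>j<(1::nat). (fourier_sum p n (\<lambda>S. \<rho> ^ card S * fourier p n f S) x)\<^sup>2)\<^sup>2)"
    by (simp add: Lr_norm_4)
  also have "\<dots> \<le> (\<Sum>S\<in>Pow {1..n}. (3 * blambda p * \<rho> ^ 4) ^ card S *
      (\<Sum>j<(1::nat). superset_weight n (fourier p n f) S)\<^sup>2)"
    by (rule vector_hypercontractivity[OF assms(1,2) \<rho>])
  also have "\<dots> = (\<Sum>S\<in>Pow {1..n}. (3 * blambda p * \<rho> ^ 4) ^ card S *
      ((Lr_norm p n 2 (deriv_S p n S f))\<^sup>2)\<^sup>2)"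
    by (rule sum.cong) (simp_all only: Lr_norm_2 Pow_iff expect_deriv_S[OF assms(1,2)], simp)
  finally show "Lr_norm p n 4 (noise p n \<rho> f) ^ 4
      \<le> (\<Sum>S\<in>Pow {1..n}. (3 * blambda p * \<rho> ^ 4) ^ card S * Lr_norm p n 2 (deriv_S p n S f) ^ 4)"
    by simp
next
  have s: "0 < bsigma p"
    using assms(1,2) by (rule bsigma_pos)
  \<comment> \<open>On the unit interval cubes are at most their bases, and \<open>p\<close> and
    \<open>1 - p\<close> sum to 1; hence \<lambda> is at most
    \<open>1 / (bsigma p)\<^sup>2\<close>.\<close>
  have "(1 - p) ^ 3 \<le> (1 - p) ^ 1" "p ^ 3 \<le> p ^ 1"
    using assms(1,2) by (intro power_decreasing; simp)+
  then have "blambda p \<le> 1 / (bsigma p)\<^sup>2"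
    unfolding blambda_def by (intro divide_right_mono) auto
  \<comment> \<open>Written over \<open>bsigma p ^ 4\<close> because the squared influence carries
    this denominator once per element of \<open>S\<close>; the comparison is then termwise.\<close>
  also have "\<dots> = (bsigma p)\<^sup>2 / bsigma p ^ 4"
    using s by (simp add: power2_eq_square power4_eq_xxxx)
  finally have "3 * blambda p * \<rho> ^ 4 \<le> 3 * ((bsigma p)\<^sup>2 / bsigma p ^ 4) * \<rho> ^ 4"
    by (intro mult_right_mono mult_left_mono) auto
  then have w: "3 * blambda p * \<rho> ^ 4 \<le> 3 * (bsigma p)\<^sup>2 * \<rho> ^ 4 / bsigma p ^ 4"
    by simp
  have w0: "0 \<le> 3 * blambda p * \<rho> ^ 4"
    using assms(1,2) by (simp add: blambda_def)
  show "(\<Sum>S\<in>Pow {1..n}. (3 * blambda p * \<rho> ^ 4) ^ card S * Lr_norm p n 2 (deriv_S p n S f) ^ 4)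
      \<le> (\<Sum>S\<in>Pow {1..n}. (3 * (bsigma p)\<^sup>2 * \<rho> ^ 4) ^ card S * (gen_influence p n S f)\<^sup>2)"
  proof (rule sum_mono)
    fix S
    let ?D = "Lr_norm p n 2 (deriv_S p n S f)"
    have "(3 * blambda p * \<rho> ^ 4) ^ card S * ?D ^ 4
        \<le> (3 * (bsigma p)\<^sup>2 * \<rho> ^ 4 / bsigma p ^ 4) ^ card S * ?D ^ 4"
      by (intro mult_right_mono power_mono w w0) simp
    also have "\<dots> = (3 * (bsigma p)\<^sup>2 * \<rho> ^ 4) ^ card S * (gen_influence p n S f)\<^sup>2"
      by (simp add: gen_influence_def power_divide flip: power_mult)
    finally show "(3 * blambda p * \<rho> ^ 4) ^ card S * ?D ^ 4
        \<le> (3 * (bsigma p)\<^sup>2 * \<rho> ^ 4) ^ card S * (gen_influence p n S f)\<^sup>2" .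
  qed
qed

end
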